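(* Let $\xi>-1$ be real. There are no first-order self-adjoint differential operators $A,B$ on $\mathcal{A}_\xi^2$ such that $\overline{[A,B]}=\eta I$ for some $\eta\in\mathbb{C}\setminus\{0\}$, where $I$ is the identity operator on $\mathcal{A}_\xi^2$.
   Context: $\mathbb{D}=\{z\in\mathbb{C}:|z|<1\}$, $H(\mathbb{D})$ is the space of holomorphic functions on $\mathbb{D}$, and $dz$ denotes the Euclidean (area) measure on $\mathbb{C}$. For $\xi>-1$ let $d\nu_\xi(z)=\frac{\xi+1}{\pi}(1-|z|^2)^\xi\,dz$, a probability measure on $\mathbb{D}$. The weighted Bergman space $\mathcal{A}_\xi^2$ is the Hilbert space of $f\in H(\mathbb{D})$ with $\|f\|_\xi^2=\int_{\mathbb{D}}|f|^2\,d\nu_\xi<\infty$, with inner product $\langle f,g\rangle_\xi=\int_{\mathbb{D}}f\overline{g}\,d\nu_\xi$. $P(\mathbb{D})\subseteq\mathcal{A}_\xi^2$ is the space of polynomials in $z$. A first-order differential operator is one of the form $L=f\frac{d}{dz}+g$ with $f,g\in\mathcal{A}_\xi^2$ and domain $P(\mathbb{D})$, $Lp=fp'+gp$. A first-order self-adjoint differential operator on $\mathcal{A}_\xi^2$ is a (generally unbounded) self-adjoint operator on $\mathcal{A}_\xi^2$ which extends such an operator $L$. The commutator is $[A,B]=AB-BA$ with its natural domain $\{u\in\mathcal{D}(A)\cap\mathcal{D}(B): Au\in\mathcal{D}(B),\ Bu\in\mathcal{D}(A)\}$, and $\overline{[A,B]}$ denotes its closure. *)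

theory Defs
  imports "HOL-Complex_Analysis.Complex_Analysis" "HOL-Computational_Algebra.Polynomial"
begin

abbreviation unit_disc :: "complex set" where
  "unit_disc \<equiv> ball 0 1"

definition bergman_measure :: "real \<Rightarrow> complex measure" where
  "bergman_measure \<xi> = density lborel
     (\<lambda>z. ennreal (indicator unit_disc z * ((\<xi> + 1) / pi * (1 - (cmod z)\<^sup>2) powr \<xi>)))"

text \<open>A holomorphic function on the unit disc is represented by its extension by zero to the
  whole plane, so that equality of functions on the disc is equality in HOL and the space is a
  complex vector space under pointwise operations.\<close>

definition bergman_space :: "real \<Rightarrow> (complex \<Rightarrow> complex) set" where
  "bergman_space \<xi> = {f. f holomorphic_on unit_disc \<and> (\<forall>z. z \<notin> unit_disc \<longrightarrow> f z = 0) \<and>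
     integrable (bergman_measure \<xi>) (\<lambda>z. (cmod (f z))\<^sup>2)}"

definition bergman_inner :: "real \<Rightarrow> (complex \<Rightarrow> complex) \<Rightarrow> (complex \<Rightarrow> complex) \<Rightarrow> complex" where
  "bergman_inner \<xi> f g = (\<integral>z. f z * cnj (g z) \<partial>bergman_measure \<xi>)"

definition bergman_norm :: "real \<Rightarrow> (complex \<Rightarrow> complex) \<Rightarrow> real" where
  "bergman_norm \<xi> f = sqrt (\<integral>z. (cmod (f z))\<^sup>2 \<partial>bergman_measure \<xi>)"

text \<open>Unbounded operators are given by their graphs: the domain of \<open>T\<close> is \<open>Domain T\<close>, and
  \<open>S \<subseteq> T\<close> says that \<open>T\<close> extends \<open>S\<close>.\<close>

type_synonym operator_graph = "((complex \<Rightarrow> complex) \<times> (complex \<Rightarrow> complex)) set"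

definition linear_operator :: "real \<Rightarrow> operator_graph \<Rightarrow> bool" where
  "linear_operator \<xi> T \<longleftrightarrow>
     T \<subseteq> bergman_space \<xi> \<times> bergman_space \<xi> \<and> single_valued T \<and> ((\<lambda>z. 0), (\<lambda>z. 0)) \<in> T \<and>
     (\<forall>u v x y a b. (u, v) \<in> T \<longrightarrow> (x, y) \<in> T \<longrightarrow>
        ((\<lambda>z. a * u z + b * x z), (\<lambda>z. a * v z + b * y z)) \<in> T)"

definition densely_defined :: "real \<Rightarrow> operator_graph \<Rightarrow> bool" where
  "densely_defined \<xi> T \<longleftrightarrow>
     (\<forall>u \<in> bergman_space \<xi>. \<forall>e > 0. \<exists>x \<in> Domain T. bergman_norm \<xi> (\<lambda>z. u z - x z) < e)"

definition adjoint_operator :: "real \<Rightarrow> operator_graph \<Rightarrow> operator_graph" where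
  "adjoint_operator \<xi> T = {(u, v). u \<in> bergman_space \<xi> \<and> v \<in> bergman_space \<xi> \<and>
     (\<forall>(x, y) \<in> T. bergman_inner \<xi> y u = bergman_inner \<xi> x v)}"

definition self_adjoint_operator :: "real \<Rightarrow> operator_graph \<Rightarrow> bool" where
  "self_adjoint_operator \<xi> T \<longleftrightarrow>
     linear_operator \<xi> T \<and> densely_defined \<xi> T \<and> adjoint_operator \<xi> T = T"

definition disc_poly :: "complex poly \<Rightarrow> complex \<Rightarrow> complex" where
  "disc_poly p z = (if z \<in> unit_disc then poly p z else 0)"

definition first_order_operator ::
    "(complex \<Rightarrow> complex) \<Rightarrow> (complex \<Rightarrow> complex) \<Rightarrow> operator_graph" where
  "first_order_operator f g =
     {(disc_poly p, \<lambda>z. f z * disc_poly (pderiv p) z + g z * disc_poly p z) | p. True}"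

definition first_order_self_adjoint :: "real \<Rightarrow> operator_graph \<Rightarrow> bool" where
  "first_order_self_adjoint \<xi> T \<longleftrightarrow> self_adjoint_operator \<xi> T \<and>
     (\<exists>f \<in> bergman_space \<xi>. \<exists>g \<in> bergman_space \<xi>. first_order_operator f g \<subseteq> T)"

definition commutator :: "operator_graph \<Rightarrow> operator_graph \<Rightarrow> operator_graph" where
  "commutator A B = {(u, \<lambda>z. ab z - ba z) | u a b ab ba.
     (u, a) \<in> A \<and> (u, b) \<in> B \<and> (b, ab) \<in> A \<and> (a, ba) \<in> B}"

text \<open>Closure of the graph in the product of two copies of the Bergman space. The general
  topological \<open>closure\<close> does not apply, since the topology on the function type is that of
  pointwise convergence. If the result is the graph of an operator, then \<open>T\<close> is closable and
  this operator is its closure.\<close>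

definition operator_closure :: "real \<Rightarrow> operator_graph \<Rightarrow> operator_graph" where
  "operator_closure \<xi> T = {(u, v). u \<in> bergman_space \<xi> \<and> v \<in> bergman_space \<xi> \<and>
     (\<exists>x y. (\<forall>n::nat. (x n, y n) \<in> T) \<and>
        (\<lambda>n. bergman_norm \<xi> (\<lambda>z. x n z - u z)) \<longlonglongrightarrow> 0 \<and>
        (\<lambda>n. bergman_norm \<xi> (\<lambda>z. y n z - v z)) \<longlonglongrightarrow> 0)}"

definition scalar_operator :: "real \<Rightarrow> complex \<Rightarrow> operator_graph" where
  "scalar_operator \<xi> c = {(u, \<lambda>z. c * u z) | u. u \<in> bergman_space \<xi>}"

end

theory Submission
  imports Defs
begin

text \<open>
  Symmetry on the polynomials forces a first-order operator \<open>f d/dz + g\<close> to have \<open>f = a + b z + e z\<^sup>2\<close> and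
  \<open>g = c + d z\<close>. Indeed monomials are orthogonal, with squared norms \<open>w m\<close> equal to the integrals of
  \<open>|z|\<^sup>2\<^sup>m\<close>, and the operator lowers degrees by at most one, hence by symmetry also raises them by at
  most one (\<open>first_order_self_adjoint_polynomial\<close>). Comparing the lowering with the raising part gives
  \<open>(j e + d) w (j + 1) = (j + 1) cnj a w j\<close> for all \<open>j\<close>, so \<open>d = \<alpha> cnj a\<close> and \<open>e = \<beta> cnj a\<close> with real
  \<open>\<alpha>\<close> and \<open>\<beta>\<close> that depend only on \<open>w\<close>.

  Two such operators map polynomials to polynomials, so polynomials lie in the domain of their
  commutator, and on polynomials the commutator is again a first-order operator \<open>h d/dz + k\<close>. If its
  closure is \<open>\<eta> I\<close>, then \<open>h = 0\<close> and \<open>k = \<eta>\<close>. With primes for the second operator, the constant term of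
  \<open>k\<close> is \<open>a d' - a' d = \<alpha> (a cnj a' - a' cnj a)\<close>, and the linear term of \<open>h\<close> is
  \<open>2 (a e' - a' e) = 2 \<beta> (a cnj a' - a' cnj a)\<close>. The latter vanishes, so either \<open>\<eta> = 0\<close> or \<open>\<beta> = 0\<close>.
  The second alternative is that of Fock space: it makes \<open>w (j + 1) / w j = (j + 1) / \<alpha>\<close>
  unbounded, whereas the moments \<open>w j\<close> of a measure on the disc decrease (\<open>ladder_bracket_zero\<close>).

  The inner product of a holomorphic function with \<open>z\<^sup>m\<close> picks out its \<open>m\<close>-th Taylor coefficient because
  the weight is invariant under rotations (\<open>bergman_inner_monomial\<close>).
\<close>

section \<open>Rotation invariance of the Bergman measure\<close>

text \<open>Uniqueness of Haar measure, in the form suited to isometries. With \<open>D\<close> the unit ball, the double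
  integral of \<open>1\<^sub>E(x) 1\<^sub>D(y)\<close> against \<open>\<mu> \<times> lborel\<close> is \<open>\<mu>(E) |D|\<close>. Substituting in turn \<open>y \<mapsto> y - x\<close>,
  \<open>x \<mapsto> x + y\<close> and \<open>y \<mapsto> y - x\<close>, with a change of the order of integration in between, moves \<open>E\<close> to
  the variable \<open>y\<close> and \<open>D\<close> to the variable \<open>x\<close>, which gives \<open>|E| \<mu>(D)\<close>. Agreement on \<open>D\<close> fixes the
  constant, and agreement on all balls makes \<open>\<mu>\<close> \<open>\<sigma>\<close>-finite.\<close>

lemma translation_invariant_measure_eq_lborel:
  fixes \<mu> :: "'a::euclidean_space measure"
  assumes sets [measurable_cong]: "sets \<mu> = sets borel"
    and invariant: "\<And>c. distr \<mu> borel ((+) c) = \<mu>"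
    and balls: "\<And>r. emeasure \<mu> (ball 0 r) = emeasure lborel (ball (0::'a) r)"
  shows "\<mu> = lborel"
proof (rule measure_eqI)
  show "sets \<mu> = sets lborel" by (simp add: sets)
  have space: "space \<mu> = UNIV"
    using sets_eq_imp_space_eq[OF sets] by simp
  have finite_ball: "emeasure lborel (ball (0::'a) r) < \<infinity>" for r
    by (intro emeasure_bounded_finite bounded_ball)
  interpret \<mu>: sigma_finite_measure \<mu>
  proof
    show "\<exists>A. countable A \<and> A \<subseteq> sets \<mu> \<and> \<Union>A = space \<mu> \<and> (\<forall>a\<in>A. emeasure \<mu> a \<noteq> \<infinity>)"
    proof (intro exI[of _ "range (\<lambda>n. ball 0 (real n))"] conjI ballI)
      show "\<Union> (range (\<lambda>n. ball (0::'a) (real n))) = space \<mu>"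
        by (auto simp: space intro: reals_Archimedean2)
    qed (use finite_ball in \<open>auto simp: sets balls less_top[symmetric]\<close>)
  qed
  interpret pair_sigma_finite \<mu> lborel ..
  let ?D = "ball (0::'a) 1"
  have [measurable]: "?D \<in> sets borel" by simp
  fix E assume "E \<in> sets \<mu>"
  then have [measurable]: "E \<in> sets borel" by (simp add: sets)
  have shift: "(\<integral>\<^sup>+y. f (c + y) \<partial>M) = (\<integral>\<^sup>+y. f y \<partial>M)"
    if "distr M borel ((+) c) = M" and "f \<in> borel_measurable borel" and "sets M = sets borel"
    for f :: "'a \<Rightarrow> ennreal" and c and M :: "'a measure"
  proof -
    have "(\<integral>\<^sup>+y. f y \<partial>M) = (\<integral>\<^sup>+y. f y \<partial>distr M borel ((+) c))"
      by (simp only: that)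
    also have "\<dots> = (\<integral>\<^sup>+y. f (c + y) \<partial>M)"
      by (rule nn_integral_distr) (use that in \<open>simp_all cong: measurable_cong_sets\<close>)
    finally show ?thesis ..
  qed
  have lborel_invariant: "distr lborel borel ((+) c) = lborel" for c :: 'a
    using lborel_affine[of 1 c] by (simp add: density_1)
  have "emeasure \<mu> E * emeasure lborel ?D =
      (\<integral>\<^sup>+x. \<integral>\<^sup>+y. indicator E x * indicator ?D y \<partial>lborel \<partial>\<mu>)"
    by (simp add: nn_integral_cmult_indicator[where M=lborel] nn_integral_multc sets)
  also have "\<dots> = (\<integral>\<^sup>+x. \<integral>\<^sup>+y. indicator E x * indicator ?D (- x + y) \<partial>lborel \<partial>\<mu>)"
    by (rule nn_integral_cong, rule shift[symmetric, OF lborel_invariant]) auto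
  also have "\<dots> = (\<integral>\<^sup>+y. \<integral>\<^sup>+x. indicator E x * indicator ?D (- x + y) \<partial>\<mu> \<partial>lborel)"
    by (intro Fubini'[symmetric]) measurable
  also have "\<dots> = (\<integral>\<^sup>+y. \<integral>\<^sup>+x. indicator E (y + x) * indicator ?D (- (y + x) + y) \<partial>\<mu> \<partial>lborel)"
    by (rule nn_integral_cong, rule shift[symmetric, OF invariant _ sets]) measurable
  also have "\<dots> = (\<integral>\<^sup>+y. \<integral>\<^sup>+x. indicator E (x + y) * indicator ?D x \<partial>\<mu> \<partial>lborel)"
    by (intro nn_integral_cong) (simp add: indicator_def add.commute)
  also have "\<dots> = (\<integral>\<^sup>+x. \<integral>\<^sup>+y. indicator E (x + y) * indicator ?D x \<partial>lborel \<partial>\<mu>)"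
    by (intro Fubini') measurable
  also have "\<dots> = (\<integral>\<^sup>+x. \<integral>\<^sup>+y. indicator E y * indicator ?D x \<partial>lborel \<partial>\<mu>)"
    by (rule nn_integral_cong, rule shift[OF lborel_invariant]) auto
  also have "\<dots> = emeasure lborel E * emeasure lborel ?D"
    by (simp add: nn_integral_cmult nn_integral_multc sets balls)
  finally have eq: "emeasure \<mu> E * emeasure lborel ?D = emeasure lborel E * emeasure lborel ?D" .
  have "emeasure lborel ?D \<noteq> 0" "emeasure lborel ?D \<noteq> top"
    using finite_ball[of 1] by (simp_all add: emeasure_ball less_imp_neq[OF unit_ball_vol_pos, symmetric])
  with eq show "emeasure \<mu> E = emeasure lborel E"
    by (metis ennreal_mult_cancel_left mult.commute)
qed

text \<open>Since \<open>c + T x = T (b + x)\<close> for \<open>c = T b\<close>, the image of Lebesgue measure under \<open>T\<close> is again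
  translation invariant, and \<open>T\<close> maps each centred ball onto itself.\<close>

lemma lborel_distr_orthogonal_transformation:
  fixes T :: "'a::euclidean_space \<Rightarrow> 'a"
  assumes T: "orthogonal_transformation T"
  shows "distr lborel borel T = lborel"
proof (rule translation_invariant_measure_eq_lborel)
  have "linear T" by (rule orthogonal_transformation_linear[OF T])
  then have [measurable]: "T \<in> borel_measurable borel"
    by (intro borel_measurable_continuous_onI linear_continuous_on linear_conv_bounded_linear[THEN iffD1])
  show "sets (distr lborel borel T) = sets borel" by simp
  show "distr (distr lborel borel T) borel ((+) c) = distr lborel borel T" for c
  proof -
    from orthogonal_transformation_surj[OF T] obtain b where b: "c = T b"
      by (metis surj_def)
    have "(+) c \<circ> T = T \<circ> (+) b"
      by (auto simp: b linear_add[OF \<open>linear T\<close>])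
    then have "distr (distr lborel borel T) borel ((+) c) = distr (distr lborel borel ((+) b)) borel T"
      by (simp add: distr_distr)
    also have "distr lborel borel ((+) b) = lborel"
      using lborel_affine[of 1 b] by (simp add: density_1)
    finally show ?thesis .
  qed
  show "emeasure (distr lborel borel T) (ball 0 r) = emeasure lborel (ball (0::'a) r)" for r
  proof -
    have "T -` ball 0 r = ball 0 r"
      by (auto simp: orthogonal_transformation_norm[OF T])
    then show ?thesis by (simp add: emeasure_distr)
  qed
qed

lemma bergman_weight_measurable [measurable]:
  "(\<lambda>z. ennreal (indicator unit_disc z * ((\<xi> + 1) / pi * (1 - (cmod z)\<^sup>2) powr \<xi>)))
     \<in> borel_measurable borel"
proof -
  have [measurable]: "unit_disc \<in> sets borel" by simp
  show ?thesis by measurable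
qed

lemma bergman_measure_distr_rotation:
  assumes w: "cmod w = 1"
  shows "distr (bergman_measure \<xi>) borel ((*) w) = bergman_measure \<xi>"
proof -
  let ?\<phi> = "\<lambda>z. ennreal (indicator unit_disc z * ((\<xi> + 1) / pi * (1 - (cmod z)\<^sup>2) powr \<xi>))"
  have [measurable]: "(*) w \<in> borel_measurable borel" by simp
  have T: "orthogonal_transformation ((*) w)"
    unfolding orthogonal_transformation
    by (auto simp: norm_mult w intro!: bounded_linear.linear bounded_linear_mult_right)
  have "bergman_measure \<xi> = density (distr lborel borel ((*) w)) ?\<phi>"
    by (simp add: bergman_measure_def lborel_distr_orthogonal_transformation[OF T])
  also have "\<dots> = distr (density lborel (\<lambda>z. ?\<phi> (w * z))) borel ((*) w)"
    by (rule density_distr[OF bergman_weight_measurable]) simp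
  also have "(\<lambda>z. ?\<phi> (w * z)) = ?\<phi>"
    by (auto simp: norm_mult w indicator_def)
  finally show ?thesis by (simp add: bergman_measure_def)
qed

section \<open>Inner products with monomials\<close>

text \<open>The indicator keeps the integrand bounded on the plane, of which only the disc carries mass.\<close>

definition disc_moment :: "real \<Rightarrow> nat \<Rightarrow> real" where
  "disc_moment \<xi> m = (\<integral>z. indicator unit_disc z * cmod z ^ (2 * m) \<partial>bergman_measure \<xi>)"

lemma sets_bergman_measure [measurable_cong, simp]: "sets (bergman_measure \<xi>) = sets borel"
  by (simp add: bergman_measure_def)

lemma space_bergman_measure [simp]: "space (bergman_measure \<xi>) = UNIV"
  by (simp add: bergman_measure_def)

lemma borel_measurable_cnj [measurable]: "cnj \<in> borel_measurable borel"
  by (intro borel_measurable_continuous_onI continuous_intros)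

text \<open>Cauchy's formula for the \<open>m\<close>-th derivative at \<open>0\<close>, applied to \<open>u \<mapsto> h (z u)\<close> on the unit circle. Moving
  the radius of the circle into the function treats \<open>z = 0\<close> on the same footing as the other points.\<close>

lemma circle_mean_eq_coeff:
  assumes h: "h holomorphic_on unit_disc" and z: "z \<in> unit_disc"
  shows "((\<lambda>t. h (cis (2 * pi * t) * z) * cnj ((cis (2 * pi * t) * z) ^ m)) has_integral
           fps_nth (fps_expansion h 0) m * of_real (cmod z ^ (2 * m))) {0..1}"
proof -
  let ?k = "\<lambda>u. h (z * u)"
  have in_disc: "z * u \<in> unit_disc" if "cmod u \<le> 1" for u
  proof -
    have "cmod z * cmod u \<le> cmod z * 1" by (intro mult_left_mono that) auto
    with z show ?thesis by (simp add: norm_mult)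
  qed
  have "continuous_on unit_disc h" by (rule holomorphic_on_imp_continuous_on[OF h])
  then have cont: "continuous_on (cball 0 1) ?k"
    by (rule continuous_on_compose2) (use in_disc in \<open>auto intro!: continuous_intros\<close>)
  have hol: "?k holomorphic_on ball 0 1"
    by (rule holomorphic_on_compose_gen[OF _ h, unfolded o_def])
      (use in_disc in \<open>auto intro!: holomorphic_intros\<close>)
  have deriv_k: "(deriv ^^ m) ?k 0 = z ^ m * (deriv ^^ m) h 0"
    using higher_deriv_compose_linear[OF h, of unit_disc 0 z m] in_disc by auto
  have "((\<lambda>u. ?k u / (u - 0) ^ Suc m) has_contour_integral
      2 * pi * \<i> / fact m * (deriv ^^ m) ?k 0) (circlepath 0 1)"
    by (rule Cauchy_has_contour_integral_higher_derivative_circlepath[OF cont hol]) simp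
  then have "((\<lambda>t. ?k (circlepath 0 1 t) / circlepath 0 1 t ^ Suc m *
      vector_derivative (circlepath 0 1) (at t within {0..1})) has_integral
      2 * pi * \<i> / fact m * (deriv ^^ m) ?k 0) {0..1}"
    by (simp add: has_contour_integral_def)
  then have "((\<lambda>t. (?k (circlepath 0 1 t) / circlepath 0 1 t ^ Suc m *
      vector_derivative (circlepath 0 1) (at t within {0..1})) * (cnj (z ^ m) / (2 * pi * \<i>))) has_integral
      2 * pi * \<i> / fact m * (deriv ^^ m) ?k 0 * (cnj (z ^ m) / (2 * pi * \<i>))) {0..1}"
    by (rule has_integral_mult_left)
  also have "2 * pi * \<i> / fact m * (deriv ^^ m) ?k 0 * (cnj (z ^ m) / (2 * pi * \<i>)) =
      (deriv ^^ m) h 0 / fact m * (z ^ m * cnj (z ^ m))"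
    by (simp add: deriv_k)
  also have "z ^ m * cnj (z ^ m) = of_real (cmod z ^ (2 * m))"
    using complex_norm_square[of "z ^ m"]
    by (simp add: norm_power power_mult[symmetric] mult.commute)
  finally have int: "((\<lambda>t. (?k (circlepath 0 1 t) / circlepath 0 1 t ^ Suc m *
      vector_derivative (circlepath 0 1) (at t within {0..1})) * (cnj (z ^ m) / (2 * pi * \<i>))) has_integral
      fps_nth (fps_expansion h 0) m * of_real (cmod z ^ (2 * m))) {0..1}"
    by (simp add: fps_expansion_def)
  show ?thesis
  proof (rule has_integral_eq[OF _ int])
    fix t :: real assume t: "t \<in> {0..1}"
    define e where "e = cis (2 * pi * t)"
    have circle: "circlepath 0 1 t = e"
      by (simp add: circlepath e_def cis_conv_exp mult_ac)
    have "e \<noteq> 0" by (simp add: e_def)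
    \<comment> \<open>On the unit circle conjugation is inversion, so the Cauchy kernel is a conjugated monomial.\<close>
    have "cnj e = 1 / e" by (simp add: e_def cis_cnj inverse_eq_divide cis_inverse[symmetric])
    with \<open>e \<noteq> 0\<close> have cnj_e: "cnj (e ^ m) = 1 / e ^ m"
      by (simp add: power_one_over)
    have vd: "vector_derivative (circlepath 0 1) (at t within {0..1}) = 2 * pi * \<i> * e"
      using vector_derivative_circlepath01[of t 0 1] t by (simp add: e_def cis_conv_exp mult_ac)
    show "(?k (circlepath 0 1 t) / circlepath 0 1 t ^ Suc m *
      vector_derivative (circlepath 0 1) (at t within {0..1})) * (cnj (z ^ m) / (2 * pi * \<i>)) =
      h (cis (2 * pi * t) * z) * cnj ((cis (2 * pi * t) * z) ^ m)"
      using \<open>e \<noteq> 0\<close> cnj_e unfolding circle vd e_def[symmetric]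
      by (simp add: power_mult_distrib mult.commute)
  qed
qed

lemma bergman_space_measurable:
  assumes "h \<in> bergman_space \<xi>"
  shows "h \<in> borel_measurable borel"
proof -
  have "(\<lambda>z. indicator unit_disc z *\<^sub>R h z) \<in> borel_measurable borel"
    using assms by (intro borel_measurable_continuous_on_indicator)
      (auto simp: bergman_space_def intro: holomorphic_on_imp_continuous_on)
  also have "(\<lambda>z. indicator unit_disc z *\<^sub>R h z) = h"
    using assms by (auto simp: bergman_space_def indicator_def)
  finally show ?thesis .
qed

lemma integrable_bergman_inner:
  assumes "u \<in> bergman_space \<xi>" and "v \<in> bergman_space \<xi>"
  shows "integrable (bergman_measure \<xi>) (\<lambda>z. u z * cnj (v z))"
proof (rule Bochner_Integration.integrable_bound)
  have [measurable]: "u \<in> borel_measurable borel" "v \<in> borel_measurable borel"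
    using assms by (auto intro: bergman_space_measurable)
  show "integrable (bergman_measure \<xi>) (\<lambda>z. (cmod (u z))\<^sup>2 + (cmod (v z))\<^sup>2)"
    using assms by (auto simp: bergman_space_def)
  show "(\<lambda>z. u z * cnj (v z)) \<in> borel_measurable (bergman_measure \<xi>)"
    by measurable
  have "cmod (u z * cnj (v z)) \<le> norm ((cmod (u z))\<^sup>2 + (cmod (v z))\<^sup>2)" for z
    using sum_squares_bound[of "cmod (u z)" "cmod (v z)"]
      mult_nonneg_nonneg[OF norm_ge_zero[of "u z"] norm_ge_zero[of "v z"]]
    unfolding norm_mult complex_mod_cnj real_norm_def by linarith
  then show "AE z in bergman_measure \<xi>. cmod (u z * cnj (v z)) \<le> norm ((cmod (u z))\<^sup>2 + (cmod (v z))\<^sup>2)"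
    by simp
qed

text \<open>The total mass is the squared norm of the constant function \<open>1\<close>. An operator whose domain contains
  the polynomials therefore carries the finiteness of the measure with it, and the weight need not be
  integrated.\<close>

lemma finite_bergman_measure:
  assumes "disc_poly 1 \<in> bergman_space \<xi>"
  shows "finite_measure (bergman_measure \<xi>)"
proof
  let ?M = "bergman_measure \<xi>"
  have "integrable ?M (\<lambda>z. (cmod (disc_poly 1 z))\<^sup>2)"
    using assms by (simp add: bergman_space_def)
  also have "(\<lambda>z. (cmod (disc_poly 1 z))\<^sup>2) = indicator unit_disc"
    by (auto simp: disc_poly_def indicator_def)
  finally have "emeasure ?M unit_disc < \<infinity>"
    by (simp add: integrable_indicator_iff)
  also have "emeasure ?M unit_disc = emeasure ?M UNIV"
    unfolding bergman_measure_def
    by (subst (1 2) emeasure_density) (measurable, auto intro!: nn_integral_cong simp: indicator_def)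
  finally show "emeasure ?M (space ?M) \<noteq> \<infinity>" by simp
qed

lemma disc_poly_in_bergman_space:
  assumes "finite_measure (bergman_measure \<xi>)"
  shows "disc_poly p \<in> bergman_space \<xi>"
proof -
  interpret finite_measure "bergman_measure \<xi>" by fact
  have "disc_poly p holomorphic_on unit_disc \<longleftrightarrow> poly p holomorphic_on unit_disc"
    by (rule holomorphic_cong) (auto simp: disc_poly_def)
  then have hol: "disc_poly p holomorphic_on unit_disc"
    by (simp add: poly_holomorphic_on)
  have "(\<lambda>z. indicator unit_disc z *\<^sub>R poly p z) \<in> borel_measurable borel"
    by (intro borel_measurable_continuous_on_indicator continuous_intros) auto
  also have "(\<lambda>z. indicator unit_disc z *\<^sub>R poly p z) = disc_poly p"
    by (auto simp: disc_poly_def indicator_def)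
  finally have [measurable]: "disc_poly p \<in> borel_measurable borel" .
  have "bounded (poly p ` cball 0 1)"
    by (intro compact_imp_bounded compact_continuous_image continuous_intros) auto
  then obtain C where C: "cmod (poly p z) \<le> C" if "z \<in> cball 0 1" for z
    unfolding bounded_iff by blast
  have "cmod (disc_poly p z) \<le> C" for z
    using C[of z] C[of 0] norm_ge_zero[of "poly p 0"] by (auto simp: disc_poly_def simp del: norm_ge_zero)
  then have "(cmod (disc_poly p z))\<^sup>2 \<le> C\<^sup>2" for z
    by (intro power_mono) auto
  then have "integrable (bergman_measure \<xi>) (\<lambda>z. (cmod (disc_poly p z))\<^sup>2)"
    by (intro integrable_const_bound[where B="C\<^sup>2"]) auto
  with hol show ?thesis by (auto simp: bergman_space_def disc_poly_def)
qed

text \<open>The product \<open>\<phi>\<close> of \<open>h\<close> and the conjugate monomial has the same integral as each of its rotations,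
  hence the same integral as the mean of \<open>\<phi>\<close> over all rotations. By Cauchy's formula that mean, at \<open>z\<close>,
  is \<open>|z|\<^sup>2\<^sup>m\<close> times the \<open>m\<close>-th Taylor coefficient of \<open>h\<close>.\<close>

lemma bergman_inner_monomial:
  assumes fin: "finite_measure (bergman_measure \<xi>)" and h: "h \<in> bergman_space \<xi>"
  shows "bergman_inner \<xi> h (disc_poly (monom 1 m)) =
    fps_nth (fps_expansion h 0) m * of_real (disc_moment \<xi> m)"
proof -
  let ?M = "bergman_measure \<xi>"
  interpret M: finite_measure ?M by fact
  interpret pair_sigma_finite lborel ?M ..
  have hol: "h holomorphic_on unit_disc"
    using h by (simp add: bergman_space_def)
  have outside: "h z = 0" if "cmod z \<ge> 1" for z
    using h that by (simp add: bergman_space_def)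
  have [measurable]: "h \<in> borel_measurable borel"
    by (rule bergman_space_measurable[OF h])
  define \<phi> where "\<phi> z = h z * cnj (z ^ m)" for z
  have \<phi>: "\<phi> z = h z * cnj (disc_poly (monom 1 m) z)" for z
    using outside[of z] by (auto simp: \<phi>_def disc_poly_def poly_monom)
  have [measurable]: "\<phi> \<in> borel_measurable borel"
    unfolding \<phi>_def by measurable
  have int_\<phi>: "integrable ?M \<phi>"
    unfolding \<phi> by (intro integrable_bergman_inner h disc_poly_in_bergman_space fin)
  have rotate: "distr ?M borel ((*) (cis t)) = ?M" for t
    by (rule bergman_measure_distr_rotation) simp
  have int_rot: "integrable ?M (\<lambda>z. \<phi> (cis t * z))" for t
  proof -
    have "integrable (distr ?M borel ((*) (cis t))) \<phi>" by (simp add: rotate int_\<phi>)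
    then show ?thesis by (subst (asm) integrable_distr_eq) auto
  qed
  have integral_rot: "(\<integral>z. f (cis t * z) \<partial>?M) = (\<integral>z. f z \<partial>?M)"
    if "f \<in> borel_measurable borel" for t and f :: "complex \<Rightarrow> 'b::{banach, second_countable_topology}"
  proof -
    have "(\<integral>z. f z \<partial>?M) = (\<integral>z. f z \<partial>distr ?M borel ((*) (cis t)))" by (simp add: rotate)
    also have "\<dots> = (\<integral>z. f (cis t * z) \<partial>?M)"
      by (rule integral_distr) (use that in auto)
    finally show ?thesis ..
  qed
  \<comment> \<open>The indicator restricts the rotation angle to one full turn.\<close>
  define F where "F t z = indicator {0..1} t *\<^sub>R \<phi> (cis (2 * pi * t) * z)" for t :: real and z
  have [measurable]: "(\<lambda>t::real. cis (2 * pi * t)) \<in> borel_measurable borel"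
    by (intro borel_measurable_continuous_onI continuous_intros)
  have F_measurable: "case_prod F \<in> borel_measurable (lborel \<Otimes>\<^sub>M ?M)"
    unfolding F_def by measurable
  have F_integrable: "integrable (lborel \<Otimes>\<^sub>M ?M) (case_prod F)"
  proof (rule Fubini_integrable[OF F_measurable])
    have "(\<integral>z. norm (case_prod F (t, z)) \<partial>?M) = indicator {0..1} t * (\<integral>z. norm (\<phi> z) \<partial>?M)" for t
      using integral_rot[of "\<lambda>z. norm (\<phi> z)" "2 * pi * t"] by (simp add: F_def indicator_def)
    then show "integrable lborel (\<lambda>t. \<integral>z. norm (case_prod F (t, z)) \<partial>?M)"
      by simp
    show "AE t in lborel. integrable ?M (\<lambda>z. case_prod F (t, z))"
      using int_rot by (simp add: F_def)
  qed
  have mean: "(\<integral>t. F t z \<partial>lborel) =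
      fps_nth (fps_expansion h 0) m * of_real (indicator unit_disc z * cmod z ^ (2 * m))" for z
  proof (cases "z \<in> unit_disc")
    case True
    have "continuous_on {0..1} (\<lambda>t. \<phi> (cis (2 * pi * t) * z))"
      unfolding \<phi>_def
      by (intro continuous_intros continuous_on_compose2[OF holomorphic_on_imp_continuous_on[OF hol]])
        (use True in \<open>auto simp: norm_mult\<close>)
    then have "set_integrable lborel {0..1} (\<lambda>t. \<phi> (cis (2 * pi * t) * z))"
      by (rule borel_integrable_atLeastAtMost')
    then have "(\<integral>t. F t z \<partial>lborel) = integral {0..1} (\<lambda>t. \<phi> (cis (2 * pi * t) * z))"
      unfolding F_def set_lebesgue_integral_def[symmetric] by (rule set_borel_integral_eq_integral)
    also have "\<dots> = fps_nth (fps_expansion h 0) m * of_real (cmod z ^ (2 * m))"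
      unfolding \<phi>_def by (rule integral_unique[OF circle_mean_eq_coeff[OF hol True]])
    finally show ?thesis using True by simp
  next
    case False
    then show ?thesis by (simp add: F_def \<phi>_def outside norm_mult)
  qed
  have "(\<integral>z. \<phi> z \<partial>?M) = (\<integral>t. indicator {0..1::real} t *\<^sub>R (\<integral>z. \<phi> z \<partial>?M) \<partial>lborel)"
    by simp
  also have "\<dots> = (\<integral>t. \<integral>z. F t z \<partial>?M \<partial>lborel)"
    using integral_rot[of \<phi>] by (simp add: F_def)
  also have "\<dots> = (\<integral>z. \<integral>t. F t z \<partial>lborel \<partial>?M)"
    by (rule Fubini_integral[OF F_integrable, symmetric])
  also have "\<dots> = fps_nth (fps_expansion h 0) m * of_real (disc_moment \<xi> m)"
    unfolding mean disc_moment_def by (simp del: of_real_mult)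
  finally show ?thesis by (simp add: bergman_inner_def \<phi>)
qed

lemma integrable_disc_moment:
  assumes "finite_measure (bergman_measure \<xi>)"
  shows "integrable (bergman_measure \<xi>) (\<lambda>z. indicator unit_disc z * cmod z ^ k)"
proof -
  interpret finite_measure "bergman_measure \<xi>" by fact
  have "unit_disc \<in> sets borel" by simp
  then have [measurable]: "(\<lambda>z. indicator unit_disc z * cmod z ^ k) \<in> borel_measurable borel"
    by measurable
  show ?thesis
    by (rule integrable_const_bound[where B=1]) (auto simp: indicator_def power_le_one)
qed

lemma disc_moment_pos:
  assumes fin: "finite_measure (bergman_measure \<xi>)" and \<xi>: "\<xi> > -1"
  shows "disc_moment \<xi> m > 0"
proof (rule ccontr)
  let ?M = "bergman_measure \<xi>"
  let ?f = "\<lambda>z. indicator unit_disc z * cmod z ^ (2 * m) :: real"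
  assume "\<not> disc_moment \<xi> m > 0"
  moreover have "disc_moment \<xi> m \<ge> 0"
    unfolding disc_moment_def by (intro integral_nonneg_AE) auto
  ultimately have "integral\<^sup>L ?M ?f = 0" unfolding disc_moment_def by linarith
  then have "AE z in ?M. ?f z = 0"
    by (subst (asm) integral_nonneg_eq_0_iff_AE) (auto intro: integrable_disc_moment[OF fin])
  then have "AE z in lborel. z \<in> unit_disc \<longrightarrow> z = 0"
    unfolding bergman_measure_def
  proof (subst (asm) AE_density, goal_cases)
    case 2
    then show ?case
    proof (rule AE_mp, intro AE_I2 impI)
      fix z assume *: "0 < ennreal (indicator unit_disc z * ((\<xi> + 1) / pi * (1 - (cmod z)\<^sup>2) powr \<xi>))
        \<longrightarrow> ?f z = 0" and z: "z \<in> unit_disc"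
      have "(cmod z)\<^sup>2 < 1" using z by (simp add: power_less_one_iff)
      with * z \<xi> show "z = 0" by auto
    qed
  qed measurable
  then have "AE z in lborel. z \<notin> unit_disc"
    using AE_lborel_singleton[of "0::complex"] by eventually_elim auto
  then have "emeasure lborel unit_disc = 0"
    by (subst (asm) AE_iff_measurable[of unit_disc]) auto
  then show False by (simp add: emeasure_ball less_imp_neq[OF unit_ball_vol_pos, symmetric])
qed

text \<open>This is where the disc enters: on the whole plane the moments could grow, as they do for the
  Gaussian weight.\<close>

lemma disc_moment_antimono:
  assumes "finite_measure (bergman_measure \<xi>)"
  shows "disc_moment \<xi> (Suc m) \<le> disc_moment \<xi> m"
  unfolding disc_moment_def
proof (rule integral_mono)
  fix z
  show "indicator unit_disc z * cmod z ^ (2 * Suc m) \<le> indicator unit_disc z * cmod z ^ (2 * m)"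
    by (auto simp: indicator_def simp del: mult_Suc_right intro!: power_decreasing)
qed (intro integrable_disc_moment assms)+

section \<open>First-order operators that are symmetric on polynomials\<close>

lemma disc_poly_has_fps_expansion: "disc_poly p has_fps_expansion fps_of_poly p"
proof -
  have "poly p has_fps_expansion fps_of_poly p"
    by (simp add: has_fps_expansion_def)
  moreover have "eventually (\<lambda>z. disc_poly p z = poly p z) (nhds 0)"
    by (rule eventually_mono[OF eventually_nhds_in_open[of unit_disc]]) (auto simp: disc_poly_def)
  ultimately show ?thesis
    by (subst has_fps_expansion_cong[where g="poly p"]) auto
qed

lemma disc_poly_eq_iff: "disc_poly p = disc_poly q \<longleftrightarrow> p = q"
  using fps_expansion_unique_complex[OF disc_poly_has_fps_expansion[of p], of "fps_of_poly q"]
    disc_poly_has_fps_expansion[of q] by (auto simp: fps_of_poly_eq_iff)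

lemma bergman_space_eq_disc_polyI:
  assumes h: "h \<in> bergman_space \<xi>" and exp: "fps_expansion h 0 = fps_of_poly p"
  shows "h = disc_poly p"
proof
  fix z
  show "h z = disc_poly p z"
  proof (cases "z \<in> unit_disc")
    case True
    have "h holomorphic_on unit_disc" using h by (simp add: bergman_space_def)
    then have "(\<lambda>n. (deriv ^^ n) h 0 / fact n * (z - 0) ^ n) sums h z"
      by (rule holomorphic_power_series) (use True in simp)
    then have "h z = eval_fps (fps_expansion h 0) z"
      by (simp add: eval_fps_def fps_expansion_def sums_iff)
    with True show ?thesis by (simp add: exp disc_poly_def)
  qed (use h in \<open>auto simp: bergman_space_def disc_poly_def\<close>)
qed

lemma bergman_inner_cnj: "cnj (bergman_inner \<xi> u v) = bergman_inner \<xi> v u"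
  unfolding bergman_inner_def
  by (subst Bochner_Integration.integral_cnj[symmetric]) (simp add: mult.commute)

text \<open>Symmetry of the operator, tested on the monomials \<open>z\<^sup>j\<close> and \<open>z\<^sup>m\<close>. The power series \<open>L j\<close> is the
  Taylor series of the image of \<open>z\<^sup>j\<close>.\<close>

lemma first_order_symmetric_coeffs:
  assumes fin: "finite_measure (bergman_measure \<xi>)"
    and A: "self_adjoint_operator \<xi> A" and ext: "first_order_operator f g \<subseteq> A"
    and f: "f \<in> bergman_space \<xi>" and g: "g \<in> bergman_space \<xi>"
  defines "L j \<equiv> fps_expansion f 0 * fps_of_poly (pderiv (monom 1 j)) + fps_expansion g 0 * fps_of_poly (monom 1 j)"
  shows "fps_nth (L j) m * disc_moment \<xi> m = cnj (fps_nth (L m) j) * disc_moment \<xi> j"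
proof -
  define l where "l k = (\<lambda>z. f z * disc_poly (pderiv (monom 1 k)) z + g z * disc_poly (monom 1 k) z)" for k
  have in_A: "(disc_poly (monom 1 k), l k) \<in> A" for k
    using ext by (auto simp: first_order_operator_def l_def)
  then have l_in: "l k \<in> bergman_space \<xi>" for k
    using A by (auto simp: self_adjoint_operator_def linear_operator_def)
  have exp: "u has_fps_expansion fps_expansion u 0" if "u \<in> bergman_space \<xi>" for u
    using that by (intro has_fps_expansion_fps_expansion[of unit_disc]) (auto simp: bergman_space_def)
  have "l k has_fps_expansion L k" for k
    unfolding l_def L_def
    by (intro has_fps_expansion_add has_fps_expansion_mult exp f g disc_poly_has_fps_expansion)
  then have L: "fps_expansion (l k) 0 = L k" for k
    by (rule fps_expansion_eqI)
  have inner: "bergman_inner \<xi> (l k) (disc_poly (monom 1 n)) = fps_nth (L k) n * disc_moment \<xi> n" for k n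
    by (simp add: bergman_inner_monomial[OF fin l_in] L)
  have "adjoint_operator \<xi> A = A"
    using A by (simp add: self_adjoint_operator_def)
  then have "(disc_poly (monom 1 m), l m) \<in> adjoint_operator \<xi> A"
    using in_A by simp
  then have "bergman_inner \<xi> (l j) (disc_poly (monom 1 m)) = bergman_inner \<xi> (disc_poly (monom 1 j)) (l m)"
    using in_A[of j] by (auto simp: adjoint_operator_def)
  also have "\<dots> = cnj (bergman_inner \<xi> (l m) (disc_poly (monom 1 j)))"
    by (simp add: bergman_inner_cnj)
  finally show ?thesis by (simp add: inner)
qed

text \<open>For \<open>m > j + 1\<close> the coefficient of \<open>z\<^sup>j\<close> in the image of \<open>z\<^sup>m\<close> vanishes, because the operator
  lowers degrees by at most one. By symmetry the image of \<open>z\<^sup>j\<close> then has no term in \<open>z\<^sup>m\<close>: the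
  operator raises degrees by at most one as well. The images of \<open>1\<close> and \<open>z\<close> turn this into the bounds
  on the degrees of \<open>f\<close> and \<open>g\<close>. The recurrence is symmetry for the pair \<open>z\<^sup>j\<close>, \<open>z\<^sup>j\<^sup>+\<^sup>1\<close>: raising
  \<open>z\<^sup>j\<close> is adjoint to lowering \<open>z\<^sup>j\<^sup>+\<^sup>1\<close>.\<close>

lemma first_order_self_adjoint_polynomial:
  assumes fin: "finite_measure (bergman_measure \<xi>)" and \<xi>: "\<xi> > -1"
    and "first_order_self_adjoint \<xi> A"
  obtains a b c d e where
    "\<And>p. (disc_poly p, disc_poly ([:a, b, e:] * pderiv p + [:c, d:] * p)) \<in> A"
    "\<And>j. (of_nat j * e + d) * disc_moment \<xi> (Suc j) = of_nat (Suc j) * cnj a * disc_moment \<xi> j"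
proof -
  obtain f g where A: "self_adjoint_operator \<xi> A" and ext: "first_order_operator f g \<subseteq> A"
    and f: "f \<in> bergman_space \<xi>" and g: "g \<in> bergman_space \<xi>"
    using assms(3) by (auto simp: first_order_self_adjoint_def)
  define F G where "F = fps_expansion f 0" and "G = fps_expansion g 0"
  note coeffs = first_order_symmetric_coeffs[OF fin A ext f g, folded F_def G_def]
  have moment: "disc_moment \<xi> m \<noteq> 0" for m
    using disc_moment_pos[OF fin \<xi>, of m] by simp
  have fps_deriv: "fps_of_poly (pderiv (monom 1 k)) = fps_const (of_nat k :: complex) * fps_X ^ (k - 1)" for k
    unfolding pderiv_monom mult_1_right by (rule fps_of_poly_monom)
  have G_high: "fps_nth G m = 0" if "m \<ge> 2" for m
  proof -
    have "fps_nth G m * disc_moment \<xi> m = 0"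
      using coeffs[of 0 m] that
      by (simp add: fps_deriv fps_of_poly_monom fps_X_power_mult_right_nth mult.left_commute[of F])
    then show ?thesis using moment by simp
  qed
  have F_high: "fps_nth F m = 0" if "m \<ge> 3" for m
  proof -
    have "(fps_nth F m + fps_nth G (m - 1)) * disc_moment \<xi> m = 0"
      using coeffs[of 1 m] that
      by (simp add: fps_deriv fps_of_poly_monom fps_X_power_mult_right_nth mult.left_commute[of F])
    then show ?thesis using moment G_high[of "m - 1"] that by simp
  qed
  have rel: "(of_nat j * fps_nth F 2 + fps_nth G 1) * disc_moment \<xi> (Suc j) =
      of_nat (Suc j) * cnj (fps_nth F 0) * disc_moment \<xi> j" for j
    using coeffs[of j "Suc j"]
    by (cases j) (simp_all add: fps_deriv fps_of_poly_monom fps_X_power_mult_right_nth mult.left_commute[of F]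
        numeral_2_eq_2 del: power_Suc)
  have "F = fps_of_poly [:fps_nth F 0, fps_nth F 1, fps_nth F 2:]"
    by (rule fps_ext) (use F_high in \<open>auto simp: coeff_pCons numeral_2_eq_2 numeral_3_eq_3 split: nat.split\<close>)
  then have f_eq: "f = disc_poly [:fps_nth F 0, fps_nth F 1, fps_nth F 2:]"
    using bergman_space_eq_disc_polyI[OF f] F_def by simp
  have "G = fps_of_poly [:fps_nth G 0, fps_nth G 1:]"
    by (rule fps_ext) (use G_high in \<open>auto simp: coeff_pCons numeral_2_eq_2 split: nat.split\<close>)
  then have g_eq: "g = disc_poly [:fps_nth G 0, fps_nth G 1:]"
    using bergman_space_eq_disc_polyI[OF g] G_def by simp
  show ?thesis
  proof (rule that[OF _ rel])
    fix p
    have "(disc_poly p, \<lambda>z. f z * disc_poly (pderiv p) z + g z * disc_poly p z) \<in> A"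
      using ext by (auto simp: first_order_operator_def)
    also have "(\<lambda>z. f z * disc_poly (pderiv p) z + g z * disc_poly p z) =
        disc_poly ([:fps_nth F 0, fps_nth F 1, fps_nth F 2:] * pderiv p + [:fps_nth G 0, fps_nth G 1:] * p)"
      by (subst f_eq, subst g_eq) (simp add: disc_poly_def fun_eq_iff algebra_simps)
    finally show "(disc_poly p, disc_poly ([:fps_nth F 0, fps_nth F 1, fps_nth F 2:] * pderiv p + [:fps_nth G 0, fps_nth G 1:] * p)) \<in> A" .
  qed
qed

lemma in_operator_closure:
  assumes "(u, v) \<in> T" and "u \<in> bergman_space \<xi>" and "v \<in> bergman_space \<xi>"
  shows "(u, v) \<in> operator_closure \<xi> T"
proof -
  have "bergman_norm \<xi> (\<lambda>z. w z - w z) = 0" for w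
    by (simp add: bergman_norm_def)
  with assms show ?thesis
    unfolding operator_closure_def
    by (intro CollectI case_prodI conjI exI[of _ "\<lambda>_. u", OF exI[of _ "\<lambda>_. v"]]) simp_all
qed

text \<open>The recurrences for \<open>j = 0\<close> and \<open>j = 1\<close> make \<open>d\<close> and \<open>e\<close> real multiples \<open>\<alpha>\<close> and \<open>\<beta>\<close> of the conjugate of
  \<open>a\<close>, with the same \<open>\<alpha>\<close> and \<open>\<beta>\<close> for both operators. So both determinants \<open>a d' - a' d\<close> and
  \<open>a e' - a' e\<close> are multiples of the same number, and the first can survive only if \<open>\<beta> = 0\<close>. But then the
  recurrence forces \<open>w j\<close> to be proportional to \<open>j! / \<alpha>\<^sup>j\<close>. These are the Gaussian moments of Fock
  space, where \<open>d/dz\<close> and \<open>z\<close> are adjoint and the canonical commutation relation does hold; they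
  eventually increase.\<close>

lemma ladder_bracket_zero:
  fixes w :: "nat \<Rightarrow> real" and a a' d d' e e' :: complex
  assumes pos: "\<And>j. w j > 0" and mono: "\<And>j. w (Suc j) \<le> w j"
    and rel: "\<And>j. (of_nat j * e + d) * w (Suc j) = of_nat (Suc j) * cnj a * w j"
    and rel': "\<And>j. (of_nat j * e' + d') * w (Suc j) = of_nat (Suc j) * cnj a' * w j"
    and quadratic: "a * e' = a' * e"
  shows "a * d' = a' * d"
proof (rule ccontr)
  assume ne: "a * d' \<noteq> a' * d"
  \<comment> \<open>These values are what the recurrence gives for \<open>j = 0\<close> and \<open>j = 1\<close>.\<close>
  define \<alpha> \<beta> where "\<alpha> = w 0 / w 1" and "\<beta> = 2 * w 1 / w 2 - \<alpha>"
  have w: "w j \<noteq> 0" for j using pos[of j] by simp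
  have d: "d = \<alpha> * cnj a" "d' = \<alpha> * cnj a'"
    using rel[of 0] rel'[of 0] w by (simp_all add: \<alpha>_def field_simps)
  have e: "e = \<beta> * cnj a" "e' = \<beta> * cnj a'"
    using rel[of 1] rel'[of 1] w d by (simp_all add: \<beta>_def field_simps numeral_2_eq_2)
  have bracket: "a * cnj a' \<noteq> a' * cnj a" using ne d by auto
  then have "a \<noteq> 0" by auto
  have "\<beta> * (a * cnj a' - a' * cnj a) = 0"
    using quadratic by (simp add: e algebra_simps)
  with bracket have "\<beta> = 0" by simp
  have "\<alpha> * w (Suc j) = Suc j * w j" for j
  proof -
    have "cnj a * of_real (\<alpha> * w (Suc j)) = cnj a * of_real (Suc j * w j)"
      using rel[of j] by (simp add: e d \<open>\<beta> = 0\<close> mult_ac)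
    then show ?thesis using \<open>a \<noteq> 0\<close> by (simp only: mult_cancel_left of_real_eq_iff complex_cnj_zero_iff) simp
  qed
  moreover have "\<alpha> > 0" by (simp add: \<alpha>_def pos)
  ultimately have "Suc j * w j \<le> \<alpha> * w j" for j
    by (metis mono mult_left_mono less_imp_le)
  then have "real (Suc j) \<le> \<alpha>" for j
    using pos[of j] by (metis mult_le_cancel_right_pos)
  moreover obtain n where "\<alpha> < real n" using reals_Archimedean2 by blast
  ultimately show False by (metis less_Suc_eq less_le_not_le of_nat_less_iff order_less_le_trans)
qed

theorem theorem11:
  fixes \<xi> :: real
  assumes "\<xi> > -1"
  shows "\<not> (\<exists>A B \<eta>. first_order_self_adjoint \<xi> A \<and> first_order_self_adjoint \<xi> B \<and>
           \<eta> \<noteq> 0 \<and> operator_closure \<xi> (commutator A B) = scalar_operator \<xi> \<eta>)"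
proof
  assume "\<exists>A B \<eta>. first_order_self_adjoint \<xi> A \<and> first_order_self_adjoint \<xi> B \<and>
           \<eta> \<noteq> 0 \<and> operator_closure \<xi> (commutator A B) = scalar_operator \<xi> \<eta>"
  then obtain A B \<eta> where A: "first_order_self_adjoint \<xi> A" and B: "first_order_self_adjoint \<xi> B"
    and "\<eta> \<noteq> 0" and closure: "operator_closure \<xi> (commutator A B) = scalar_operator \<xi> \<eta>"
    by blast
  have "disc_poly 1 \<in> bergman_space \<xi>"
    using A by (fastforce simp: first_order_self_adjoint_def self_adjoint_operator_def
        linear_operator_def first_order_operator_def)
  then have fin: "finite_measure (bergman_measure \<xi>)"
    by (rule finite_bergman_measure)
  obtain a b c d e where
    LA: "\<And>p. (disc_poly p, disc_poly ([:a, b, e:] * pderiv p + [:c, d:] * p)) \<in> A" and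
    rel: "\<And>j. (of_nat j * e + d) * disc_moment \<xi> (Suc j) = of_nat (Suc j) * cnj a * disc_moment \<xi> j"
    using first_order_self_adjoint_polynomial[OF fin assms A] by metis
  obtain a' b' c' d' e' where
    LB: "\<And>p. (disc_poly p, disc_poly ([:a', b', e':] * pderiv p + [:c', d':] * p)) \<in> B" and
    rel': "\<And>j. (of_nat j * e' + d') * disc_moment \<xi> (Suc j) = of_nat (Suc j) * cnj a' * disc_moment \<xi> j"
    using first_order_self_adjoint_polynomial[OF fin assms B] by metis
  define S T where "S p = [:a, b, e:] * pderiv p + [:c, d:] * p"
    and "T p = [:a', b', e':] * pderiv p + [:c', d':] * p" for p
  have bracket: "S (T p) - T (S p) = smult \<eta> p" for p
  proof -
    have "disc_poly (S (T p) - T (S p)) = (\<lambda>z. disc_poly (S (T p)) z - disc_poly (T (S p)) z)"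
      by (auto simp: disc_poly_def)
    then have "(disc_poly p, disc_poly (S (T p) - T (S p))) \<in> commutator A B"
      using LA[folded S_def] LB[folded T_def] unfolding commutator_def by blast
    then have "(disc_poly p, disc_poly (S (T p) - T (S p))) \<in> operator_closure \<xi> (commutator A B)"
      by (rule in_operator_closure) (simp_all add: disc_poly_in_bergman_space[OF fin])
    then have "disc_poly (S (T p) - T (S p)) = (\<lambda>z. \<eta> * disc_poly p z)"
      by (auto simp: closure scalar_operator_def)
    also have "\<dots> = disc_poly (smult \<eta> p)"
      by (auto simp: disc_poly_def)
    finally show ?thesis by (simp add: disc_poly_eq_iff)
  qed
  have \<eta>: "a * d' - a' * d = \<eta>"
    using bracket[of 1] by (simp add: S_def T_def one_pCons pderiv_pCons algebra_simps)
  \<comment> \<open>For a bracket \<open>h d/dz + k\<close> this coefficient is the sum of the linear term of \<open>h\<close> and the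
    constant term of \<open>k\<close>; the latter is already known to be \<open>\<eta>\<close>.\<close>
  have "coeff (S (T [:0, 1:]) - T (S [:0, 1:])) 1 = \<eta>"
    by (simp only: bracket) simp
  then have "2 * (a * e' - a' * e) + (a * d' - a' * d) = \<eta>"
    by (simp add: S_def T_def pderiv_pCons algebra_simps)
  with \<eta> have "a * e' = a' * e" by simp
  then have "a * d' = a' * d"
    by (rule ladder_bracket_zero[OF disc_moment_pos[OF fin assms] disc_moment_antimono[OF fin] rel rel'])
  with \<eta> \<open>\<eta> \<noteq> 0\<close> show False by simp
qed

end
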